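(* Let $A$ be a commutative Noetherian ring containing an uncountable field $K$ of characteristic zero, let $m\ge 1$, and let $M=\bigoplus_{n\in\mathbb{Z}}M_n$ be a countably generated, generalized Eulerian $A_m(A)$-module. If $M\neq 0$, then $M_n\neq 0$ for infinitely many $n\gg 0$ or $M_n\neq 0$ for infinitely many $n\ll 0$.
   Context: $A_m(A)=A\otimes_K A_m(K)=A\langle X_1,\ldots,X_m,\partial_1,\ldots,\partial_m\rangle$ is the $m$-th Weyl algebra over $A$: elements of $A$ are central, the $X_i$ commute with each other, the $\partial_i$ commute with each other, and $\partial_iX_j-X_j\partial_i=\delta_{ij}$. It is $\mathbb{Z}$-graded by $\deg z=0$ for $z\in A$, $\deg X_i=1$, $\deg\partial_i=-1$. Modules are left modules. The Euler operator is $\mathcal{E}_m=\sum_{i=1}^m X_i\partial_i$. A graded $A_m(A)$-module $M$ is generalized Eulerian if for each homogeneous $y\in M$ of degree $|y|$ there is a positive integer $a$ (depending on $y$) with $(\mathcal{E}_m-|y|)^a\cdot y=0$. A module is countably generated if it is generated by a countable set of elements. "For infinitely many $n\gg 0$" (resp. $n\ll 0$) means for infinitely many positive (resp. negative) integers $n$. *)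

theory Defs
  imports "HOL-Algebra.Ring_Divisibility" "HOL-Algebra.Subrings" "HOL-Algebra.Module" "HOL-Library.Countable_Set"
begin

section \<open>The free algebra over a commutative ring\<close>

text \<open>
  The free associative algebra \<open>R\<langle>G\<rangle>\<close>: its elements are the finitely supported
  coefficient functions on words over \<open>G\<close>, multiplied by convolution along the splittings of a
  word. Coefficients commute with the letters.
\<close>

definition free_algebra :: "('a, 'c) ring_scheme \<Rightarrow> 'g set \<Rightarrow> ('g list \<Rightarrow> 'a) ring" where
  "free_algebra R G =
    \<lparr>carrier = {f. (\<forall>w. f w \<in> carrier R) \<and> finite {w. f w \<noteq> \<zero>\<^bsub>R\<^esub>} \<and> {w. f w \<noteq> \<zero>\<^bsub>R\<^esub>} \<subseteq> lists G},
     mult = (\<lambda>f g w. \<Oplus>\<^bsub>R\<^esub>k\<in>{..length w}. f (take k w) \<otimes>\<^bsub>R\<^esub> g (drop k w)),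
     one = (\<lambda>w. if w = [] then \<one>\<^bsub>R\<^esub> else \<zero>\<^bsub>R\<^esub>),
     zero = (\<lambda>w. \<zero>\<^bsub>R\<^esub>),
     add = (\<lambda>f g w. f w \<oplus>\<^bsub>R\<^esub> g w)\<rparr>"

definition free_letter :: "('a, 'c) ring_scheme \<Rightarrow> 'g \<Rightarrow> 'g list \<Rightarrow> 'a" where
  "free_letter R x = (\<lambda>w. if w = [x] then \<one>\<^bsub>R\<^esub> else \<zero>\<^bsub>R\<^esub>)"

lemma (in abelian_monoid) finsum_triangle:
  fixes n :: nat
  assumes "\<And>i j. F i j \<in> carrier G"
  shows "(\<Oplus>k\<in>{..n}. \<Oplus>j\<in>{..k}. F j (k - j)) = (\<Oplus>j\<in>{..n}. \<Oplus>i\<in>{..n - j}. F j i)"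
proof (induction n)
  case 0
  show ?case using assms by simp
next
  case (Suc n)
  have "(\<Oplus>j\<in>{..Suc n}. \<Oplus>i\<in>{..Suc n - j}. F j i)
      = F (Suc n) 0 \<oplus> (\<Oplus>j\<in>{..n}. \<Oplus>i\<in>{..Suc n - j}. F j i)"
    using assms by (subst finsum_Suc) (auto intro!: finsum_closed)
  also have "(\<Oplus>j\<in>{..n}. \<Oplus>i\<in>{..Suc n - j}. F j i)
      = (\<Oplus>j\<in>{..n}. F j (Suc n - j) \<oplus> (\<Oplus>i\<in>{..n - j}. F j i))"
    using assms by (intro finsum_cong') (auto simp: Suc_diff_le intro!: finsum_closed)
  also have "\<dots> = (\<Oplus>j\<in>{..n}. F j (Suc n - j)) \<oplus> (\<Oplus>j\<in>{..n}. \<Oplus>i\<in>{..n - j}. F j i)"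
    using assms by (intro finsum_addf) (auto intro!: finsum_closed)
  also have "F (Suc n) 0 \<oplus> \<dots>
      = (\<Oplus>j\<in>{..Suc n}. F j (Suc n - j)) \<oplus> (\<Oplus>j\<in>{..n}. \<Oplus>i\<in>{..n - j}. F j i)"
    using assms by (subst finsum_Suc[where n = n]) (auto intro!: finsum_closed a_assoc[symmetric])
  also have "\<dots> = (\<Oplus>k\<in>{..Suc n}. \<Oplus>j\<in>{..k}. F j (k - j))"
    using assms Suc.IH by (subst finsum_Suc[where n = n and f = "\<lambda>k. \<Oplus>j\<in>{..k}. F j (k - j)"])
      (auto intro!: finsum_closed)
  finally show ?case by simp
qed

lemma (in ring) free_algebra_is_ring: "ring (free_algebra R G)"
proof -
  let ?F = "free_algebra R G"
  note F = free_algebra_def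
  have car: "f \<in> carrier ?F \<Longrightarrow> f w \<in> carrier R" for f w by (simp add: F)
  have carI: "f \<in> carrier ?F"
    if "\<And>w. f w \<in> carrier R" "{w. f w \<noteq> \<zero>} \<subseteq> S" "finite S" "S \<subseteq> lists G" for f S
    using that by (auto simp: F intro: finite_subset)
  have supp: "finite {w. f w \<noteq> \<zero>}" "{w. f w \<noteq> \<zero>} \<subseteq> lists G" if "f \<in> carrier ?F" for f
    using that by (auto simp: F)
  have add: "(f \<oplus>\<^bsub>?F\<^esub> g) = (\<lambda>w. f w \<oplus> g w)" for f g by (simp add: F)
  have mult: "(f \<otimes>\<^bsub>?F\<^esub> g) = (\<lambda>w. \<Oplus>k\<in>{..length w}. f (take k w) \<otimes> g (drop k w))" for f g
    by (simp add: F)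
  have one: "\<one>\<^bsub>?F\<^esub> = (\<lambda>w. if w = [] then \<one> else \<zero>)" by (simp add: F)
  have zero: "\<zero>\<^bsub>?F\<^esub> = (\<lambda>w. \<zero>)" by (simp add: F)
  have addc: "f \<oplus>\<^bsub>?F\<^esub> g \<in> carrier ?F" if "f \<in> carrier ?F" "g \<in> carrier ?F" for f g
    by (rule carI[of _ "{w. f w \<noteq> \<zero>} \<union> {w. g w \<noteq> \<zero>}"])
      (use that supp in \<open>auto simp: add car\<close>)
  have onec: "\<one>\<^bsub>?F\<^esub> \<in> carrier ?F"
    by (rule carI[of _ "{[]}"]) (auto simp: one)
  have multc: "f \<otimes>\<^bsub>?F\<^esub> g \<in> carrier ?F" if "f \<in> carrier ?F" "g \<in> carrier ?F" for f g
  proof (rule carI[of _ "(\<lambda>(u, v). u @ v) ` ({w. f w \<noteq> \<zero>} \<times> {w. g w \<noteq> \<zero>})"])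
    show "(f \<otimes>\<^bsub>?F\<^esub> g) w \<in> carrier R" for w
      using that by (auto simp: mult car intro!: finsum_closed)
    show "{w. (f \<otimes>\<^bsub>?F\<^esub> g) w \<noteq> \<zero>} \<subseteq> (\<lambda>(u, v). u @ v) ` ({w. f w \<noteq> \<zero>} \<times> {w. g w \<noteq> \<zero>})"
    proof clarify
      fix w assume nz: "(f \<otimes>\<^bsub>?F\<^esub> g) w \<noteq> \<zero>"
      have "\<exists>k. f (take k w) \<noteq> \<zero> \<and> g (drop k w) \<noteq> \<zero>"
      proof (rule ccontr)
        assume "\<nexists>k. f (take k w) \<noteq> \<zero> \<and> g (drop k w) \<noteq> \<zero>"
        then have "f (take k w) \<otimes> g (drop k w) = \<zero>" for k
          using that car[of f] car[of g] by (cases "f (take k w) = \<zero>") auto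
        then show False using nz by (simp add: mult)
      qed
      then obtain k where "f (take k w) \<noteq> \<zero>" "g (drop k w) \<noteq> \<zero>" by blast
      then show "w \<in> (\<lambda>(u, v). u @ v) ` ({w. f w \<noteq> \<zero>} \<times> {w. g w \<noteq> \<zero>})"
        by (intro image_eqI[of _ _ "(take k w, drop k w)"]) auto
    qed
    show "finite ((\<lambda>(u, v). u @ v) ` ({w. f w \<noteq> \<zero>} \<times> {w. g w \<noteq> \<zero>}))"
      using that supp by auto
    show "(\<lambda>(u, v). u @ v) ` ({w. f w \<noteq> \<zero>} \<times> {w. g w \<noteq> \<zero>}) \<subseteq> lists G"
      using supp(2)[OF that(1)] supp(2)[OF that(2)] by fastforce
  qed
  show ?thesis
  proof (rule ringI)
    show "abelian_group ?F"
    proof (rule abelian_groupI)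
      fix f assume f: "f \<in> carrier ?F"
      show "\<exists>g\<in>carrier ?F. g \<oplus>\<^bsub>?F\<^esub> f = \<zero>\<^bsub>?F\<^esub>"
      proof
        show "(\<lambda>w. \<ominus> f w) \<oplus>\<^bsub>?F\<^esub> f = \<zero>\<^bsub>?F\<^esub>"
          using f by (auto simp: add zero car l_neg)
        show "(\<lambda>w. \<ominus> f w) \<in> carrier ?F"
          by (rule carI[of _ "{w. f w \<noteq> \<zero>}"]) (use f supp in \<open>auto simp: car\<close>)
      qed
    next
      show "\<zero>\<^bsub>?F\<^esub> \<in> carrier ?F" by (rule carI[of _ "{}"]) (auto simp: zero)
    qed (auto simp: addc car zero, auto simp: add car a_ac zero)
    show "Group.monoid ?F"
    proof (rule monoidI)
      fix f g h assume fgh: "f \<in> carrier ?F" "g \<in> carrier ?F" "h \<in> carrier ?F"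
      show "f \<otimes>\<^bsub>?F\<^esub> g \<otimes>\<^bsub>?F\<^esub> h = f \<otimes>\<^bsub>?F\<^esub> (g \<otimes>\<^bsub>?F\<^esub> h)"
      proof
        fix w
        let ?T = "\<lambda>j i. f (take j w) \<otimes> (g (take i (drop j w)) \<otimes> h (drop (j + i) w))"
        have T: "?T j i \<in> carrier R" for i j using fgh by (simp add: car)
        have "(f \<otimes>\<^bsub>?F\<^esub> g \<otimes>\<^bsub>?F\<^esub> h) w = (\<Oplus>k\<in>{..length w}. \<Oplus>j\<in>{..k}. ?T j (k - j))"
          unfolding mult
        proof (intro finsum_cong' refl)
          fix k assume k: "k \<in> {..length w}"
          have "(\<Oplus>j\<in>{..length (take k w)}. f (take j (take k w)) \<otimes> g (drop j (take k w))) \<otimes> h (drop k w)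
            = (\<Oplus>j\<in>{..k}. f (take j (take k w)) \<otimes> g (drop j (take k w)) \<otimes> h (drop k w))"
            using k fgh by (subst finsum_ldistr) (auto simp: car min_def)
          also have "\<dots> = (\<Oplus>j\<in>{..k}. ?T j (k - j))"
            using fgh by (intro finsum_cong') (auto simp: car m_assoc drop_take min_def)
          finally show "(\<Oplus>j\<in>{..length (take k w)}. f (take j (take k w)) \<otimes> g (drop j (take k w))) \<otimes> h (drop k w)
            = (\<Oplus>j\<in>{..k}. ?T j (k - j))" .
        qed (use fgh in \<open>auto simp: car intro!: finsum_closed\<close>)
        also have "\<dots> = (\<Oplus>j\<in>{..length w}. \<Oplus>i\<in>{..length w - j}. ?T j i)"
          by (rule finsum_triangle) (rule T)
        also have "\<dots> = (f \<otimes>\<^bsub>?F\<^esub> (g \<otimes>\<^bsub>?F\<^esub> h)) w"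
          unfolding mult
        proof (intro finsum_cong' refl)
          fix j assume "j \<in> {..length w}"
          show "(\<Oplus>i\<in>{..length w - j}. ?T j i) = f (take j w) \<otimes>
            (\<Oplus>k\<in>{..length (drop j w)}. g (take k (drop j w)) \<otimes> h (drop k (drop j w)))"
            using fgh by (subst finsum_rdistr) (auto simp: car add.commute)
        qed (use fgh in \<open>auto simp: car intro!: finsum_closed\<close>)
        finally show "(f \<otimes>\<^bsub>?F\<^esub> g \<otimes>\<^bsub>?F\<^esub> h) w = (f \<otimes>\<^bsub>?F\<^esub> (g \<otimes>\<^bsub>?F\<^esub> h)) w" .
      qed
    next
      fix f assume f: "f \<in> carrier ?F"
      show "\<one>\<^bsub>?F\<^esub> \<otimes>\<^bsub>?F\<^esub> f = f"
      proof
        fix w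
        have "(\<one>\<^bsub>?F\<^esub> \<otimes>\<^bsub>?F\<^esub> f) w = (\<Oplus>k\<in>{..length w}. if 0 = k then f (drop k w) else \<zero>)"
          unfolding mult one using f by (intro finsum_cong') (auto simp: car)
        also have "\<dots> = f (drop 0 w)"
          by (rule finsum_singleton[where f = "\<lambda>k. f (drop k w)"]) (use f in \<open>auto simp: car\<close>)
        finally show "(\<one>\<^bsub>?F\<^esub> \<otimes>\<^bsub>?F\<^esub> f) w = f w" by simp
      qed
      show "f \<otimes>\<^bsub>?F\<^esub> \<one>\<^bsub>?F\<^esub> = f"
      proof
        fix w
        have "(f \<otimes>\<^bsub>?F\<^esub> \<one>\<^bsub>?F\<^esub>) w = (\<Oplus>k\<in>{..length w}. if length w = k then f (take k w) else \<zero>)"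
          unfolding mult one using f by (intro finsum_cong') (auto simp: car)
        also have "\<dots> = f (take (length w) w)"
          by (rule finsum_singleton[where f = "\<lambda>k. f (take k w)"]) (use f in \<open>auto simp: car\<close>)
        finally show "(f \<otimes>\<^bsub>?F\<^esub> \<one>\<^bsub>?F\<^esub>) w = f w" by simp
      qed
    qed (auto simp: multc onec)
  next
    fix f g h assume fgh: "f \<in> carrier ?F" "g \<in> carrier ?F" "h \<in> carrier ?F"
    show "(f \<oplus>\<^bsub>?F\<^esub> g) \<otimes>\<^bsub>?F\<^esub> h = f \<otimes>\<^bsub>?F\<^esub> h \<oplus>\<^bsub>?F\<^esub> g \<otimes>\<^bsub>?F\<^esub> h"
      unfolding mult add using fgh
      by (subst finsum_addf[symmetric]) (auto simp: car l_distr)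
    show "h \<otimes>\<^bsub>?F\<^esub> (f \<oplus>\<^bsub>?F\<^esub> g) = h \<otimes>\<^bsub>?F\<^esub> f \<oplus>\<^bsub>?F\<^esub> h \<otimes>\<^bsub>?F\<^esub> g"
      unfolding mult add using fgh
      by (subst finsum_addf[symmetric]) (auto simp: car r_distr)
  qed
qed

lemma (in ring) free_letter_closed: "x \<in> G \<Longrightarrow> free_letter R x \<in> carrier (free_algebra R G)"
  by (auto simp: free_algebra_def free_letter_def)


section \<open>The Weyl algebra\<close>

datatype weyl_gen = GenX nat | GenD nat

definition weyl_gens :: "nat \<Rightarrow> weyl_gen set" where
  "weyl_gens m = GenX ` {1..m} \<union> GenD ` {1..m}"

definition weyl_relators :: "('a, 'c) ring_scheme \<Rightarrow> nat \<Rightarrow> (weyl_gen list \<Rightarrow> 'a) set" where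
  "weyl_relators A m =
    (let F = free_algebra A (weyl_gens m);
         x = (\<lambda>i. free_letter A (GenX i));
         d = (\<lambda>i. free_letter A (GenD i))
     in {x i \<otimes>\<^bsub>F\<^esub> x j \<ominus>\<^bsub>F\<^esub> x j \<otimes>\<^bsub>F\<^esub> x i | i j. i \<in> {1..m} \<and> j \<in> {1..m}}
      \<union> {d i \<otimes>\<^bsub>F\<^esub> d j \<ominus>\<^bsub>F\<^esub> d j \<otimes>\<^bsub>F\<^esub> d i | i j. i \<in> {1..m} \<and> j \<in> {1..m}}
      \<union> {(d i \<otimes>\<^bsub>F\<^esub> x j \<ominus>\<^bsub>F\<^esub> x j \<otimes>\<^bsub>F\<^esub> d i) \<ominus>\<^bsub>F\<^esub> (if i = j then \<one>\<^bsub>F\<^esub> else \<zero>\<^bsub>F\<^esub>) | i j.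
          i \<in> {1..m} \<and> j \<in> {1..m}})"

definition weyl_ideal :: "('a, 'c) ring_scheme \<Rightarrow> nat \<Rightarrow> (weyl_gen list \<Rightarrow> 'a) set" where
  "weyl_ideal A m = Idl\<^bsub>free_algebra A (weyl_gens m)\<^esub> (weyl_relators A m)"

definition weyl_algebra :: "('a, 'c) ring_scheme \<Rightarrow> nat \<Rightarrow> (weyl_gen list \<Rightarrow> 'a) set ring" where
  "weyl_algebra A m = free_algebra A (weyl_gens m) Quot weyl_ideal A m"

definition weyl_class ::
  "('a, 'c) ring_scheme \<Rightarrow> nat \<Rightarrow> (weyl_gen list \<Rightarrow> 'a) \<Rightarrow> (weyl_gen list \<Rightarrow> 'a) set" where
  "weyl_class A m f = weyl_ideal A m +>\<^bsub>free_algebra A (weyl_gens m)\<^esub> f"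

definition weyl_X :: "('a, 'c) ring_scheme \<Rightarrow> nat \<Rightarrow> nat \<Rightarrow> (weyl_gen list \<Rightarrow> 'a) set" where
  "weyl_X A m i = weyl_class A m (free_letter A (GenX i))"

definition weyl_D :: "('a, 'c) ring_scheme \<Rightarrow> nat \<Rightarrow> nat \<Rightarrow> (weyl_gen list \<Rightarrow> 'a) set" where
  "weyl_D A m i = weyl_class A m (free_letter A (GenD i))"

definition euler_operator :: "('a, 'c) ring_scheme \<Rightarrow> nat \<Rightarrow> (weyl_gen list \<Rightarrow> 'a) set" where
  "euler_operator A m =
    (\<Oplus>\<^bsub>weyl_algebra A m\<^esub>i\<in>{1..m}. weyl_X A m i \<otimes>\<^bsub>weyl_algebra A m\<^esub> weyl_D A m i)"

fun gen_degree :: "weyl_gen \<Rightarrow> int" where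
  "gen_degree (GenX i) = 1"
| "gen_degree (GenD i) = - 1"

text \<open>
  The relators are homogeneous for the word degree, so the grading of the free algebra passes to
  the quotient: the component of degree \<open>n\<close> is the image of the elements supported on words of
  degree \<open>n\<close>.
\<close>

definition weyl_component ::
  "('a, 'c) ring_scheme \<Rightarrow> nat \<Rightarrow> int \<Rightarrow> (weyl_gen list \<Rightarrow> 'a) set set" where
  "weyl_component A m n =
    weyl_class A m ` {f \<in> carrier (free_algebra A (weyl_gens m)).
      \<forall>w. f w \<noteq> \<zero>\<^bsub>A\<^esub> \<longrightarrow> sum_list (map gen_degree w) = n}"

lemma (in ring) weyl_ideal_is_ideal: "ideal (weyl_ideal R m) (free_algebra R (weyl_gens m))"
proof -
  let ?F = "free_algebra R (weyl_gens m)"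
  interpret F: ring ?F by (rule free_algebra_is_ring)
  have "free_letter R (GenX i) \<in> carrier ?F" "free_letter R (GenD i) \<in> carrier ?F"
    if "i \<in> {1..m}" for i
    using that by (auto intro!: free_letter_closed simp: weyl_gens_def)
  then have "weyl_relators R m \<subseteq> carrier ?F"
    by (auto simp: weyl_relators_def Let_def)
  then show ?thesis
    unfolding weyl_ideal_def by (rule F.genideal_ideal)
qed

lemma (in ring) weyl_algebra_is_ring: "ring (weyl_algebra R m)"
  unfolding weyl_algebra_def by (rule ideal.quotient_is_ring[OF weyl_ideal_is_ideal])


section \<open>Graded left modules over a possibly noncommutative ring\<close>

text \<open>The locale \<^locale>\<open>module\<close> requires a commutative ring of scalars.\<close>

locale left_module = R?: ring R + M?: abelian_group M
  for R :: "('r, 'p) ring_scheme" (structure) and M :: "('r, 'b, 'q) module_scheme" (structure) +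
  assumes smult_closed:
      "\<lbrakk>a \<in> carrier R; x \<in> carrier M\<rbrakk> \<Longrightarrow> a \<odot>\<^bsub>M\<^esub> x \<in> carrier M"
    and smult_l_distr:
      "\<lbrakk>a \<in> carrier R; b \<in> carrier R; x \<in> carrier M\<rbrakk> \<Longrightarrow>
      (a \<oplus>\<^bsub>R\<^esub> b) \<odot>\<^bsub>M\<^esub> x = a \<odot>\<^bsub>M\<^esub> x \<oplus>\<^bsub>M\<^esub> b \<odot>\<^bsub>M\<^esub> x"
    and smult_r_distr:
      "\<lbrakk>a \<in> carrier R; x \<in> carrier M; y \<in> carrier M\<rbrakk> \<Longrightarrow>
      a \<odot>\<^bsub>M\<^esub> (x \<oplus>\<^bsub>M\<^esub> y) = a \<odot>\<^bsub>M\<^esub> x \<oplus>\<^bsub>M\<^esub> a \<odot>\<^bsub>M\<^esub> y"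
    and smult_assoc:
      "\<lbrakk>a \<in> carrier R; b \<in> carrier R; x \<in> carrier M\<rbrakk> \<Longrightarrow>
      (a \<otimes>\<^bsub>R\<^esub> b) \<odot>\<^bsub>M\<^esub> x = a \<odot>\<^bsub>M\<^esub> (b \<odot>\<^bsub>M\<^esub> x)"
    and smult_one:
      "x \<in> carrier M \<Longrightarrow> \<one>\<^bsub>R\<^esub> \<odot>\<^bsub>M\<^esub> x = x"

definition internal_direct_sum :: "('b, 'q) ring_scheme \<Rightarrow> ('i \<Rightarrow> 'b set) \<Rightarrow> bool" where
  "internal_direct_sum M N \<longleftrightarrow>
    (\<forall>i. additive_subgroup (N i) M) \<and>
    (\<forall>x\<in>carrier M. \<exists>!f. (\<forall>i. f i \<in> N i) \<and> finite {i. f i \<noteq> \<zero>\<^bsub>M\<^esub>} \<and>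
      x = (\<Oplus>\<^bsub>M\<^esub>i\<in>{i. f i \<noteq> \<zero>\<^bsub>M\<^esub>}. f i))"

locale graded_left_module = left_module R M
  for R :: "('r, 'p) ring_scheme" (structure) and Rgr :: "int \<Rightarrow> 'r set"
    and M :: "('r, 'b, 'q) module_scheme" (structure) and Mgr :: "int \<Rightarrow> 'b set" +
  assumes direct_sum: "internal_direct_sum M Mgr"
    and smult_graded: "\<lbrakk>a \<in> Rgr i; x \<in> Mgr j\<rbrakk> \<Longrightarrow> a \<odot>\<^bsub>M\<^esub> x \<in> Mgr (i + j)"

definition countably_generated ::
  "('r, 'p) ring_scheme \<Rightarrow> ('r, 'b, 'q) module_scheme \<Rightarrow> bool" where
  "countably_generated R M \<longleftrightarrow>
    (\<exists>S. countable S \<and> S \<subseteq> carrier M \<and> (\<forall>N. submodule N R M \<and> S \<subseteq> N \<longrightarrow> N = carrier M))"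

text \<open>
  Homogeneous elements of degree \<open>n\<close> are the members of \<open>Mgr n\<close>, zero included; for zero the
  condition is trivial. The scalar \<open>n\<close> is the multiple \<open>[n] \<cdot> \<one>\<close> in the Weyl algebra.
\<close>

definition generalized_eulerian ::
  "('a, 'c) ring_scheme \<Rightarrow> nat \<Rightarrow> ((weyl_gen list \<Rightarrow> 'a) set, 'b, 'q) module_scheme \<Rightarrow>
    (int \<Rightarrow> 'b set) \<Rightarrow> bool" where
  "generalized_eulerian A m M Mgr \<longleftrightarrow>
    (let W = weyl_algebra A m in
      \<forall>n. \<forall>y\<in>Mgr n. \<exists>a::nat. a > 0 \<and>
        ((euler_operator A m \<ominus>\<^bsub>W\<^esub> [n] \<cdot>\<^bsub>W\<^esub> \<one>\<^bsub>W\<^esub>) [^]\<^bsub>W\<^esub> a) \<odot>\<^bsub>M\<^esub> y = \<zero>\<^bsub>M\<^esub>)"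

end

theory Submission
  imports Defs
begin

text \<open>
  The reason is the classical one why the Weyl algebra in characteristic zero has no nonzero
  module on which \<open>X\<^sub>1\<close> is nilpotent. Suppose that \<open>M\<close> has only finitely many nonzero
  components. Multiplication by \<open>X\<^sub>1\<close> raises the degree by one, so some power \<open>X\<^sub>1\<^sup>N\<close> moves every
  component out of the support and annihilates \<open>M\<close>. The commutator identity
  \<open>\<partial>\<^sub>1 X\<^sub>1\<^sup>N - X\<^sub>1\<^sup>N \<partial>\<^sub>1 = N X\<^sub>1\<^bsup>N-1\<^esup>\<close> then shows that \<open>N X\<^sub>1\<^bsup>N-1\<^esup>\<close> annihilates \<open>M\<close>, and \<open>N\<close> is
  invertible because \<open>A\<close> contains a field of characteristic zero. Descending to the exponent
  \<open>0\<close> gives \<open>1 \<cdot> M = 0\<close>.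

  The descent is \<open>left_module.trivial_if_power_annihilates\<close>, the degree argument is
  \<open>graded_left_module.homogeneous_nilpotent_if_finite_support\<close>; what remains is to read off
  from the presentation of the Weyl algebra the relation between \<open>\<partial>\<^sub>1\<close> and \<open>X\<^sub>1\<close>, the degree of
  \<open>X\<^sub>1\<close>, and the ring homomorphism from \<open>A\<close>, which carries the inverses of the integers along.
\<close>

section \<open>Nilpotent action and the canonical commutation relation\<close>

lemma (in ring) commutator_power:
  fixes n :: nat
  assumes x: "x \<in> carrier R" and d: "d \<in> carrier R"
    and comm: "d \<otimes> x = x \<otimes> d \<oplus> \<one>"
  shows "d \<otimes> x [^] Suc n = x [^] Suc n \<otimes> d \<oplus> ([Suc n] \<cdot> \<one>) \<otimes> x [^] n"
proof (induction n)
  case 0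
  show ?case using x d comm by simp
next
  case (Suc n)
  let ?c = "[Suc n] \<cdot> \<one>"
  have "d \<otimes> x [^] Suc (Suc n) = (d \<otimes> x [^] Suc n) \<otimes> x"
    using x d by (simp add: m_assoc)
  also have "\<dots> = x [^] Suc n \<otimes> (d \<otimes> x) \<oplus> ?c \<otimes> x [^] Suc n"
    unfolding Suc.IH using x d by (simp add: l_distr m_assoc del: add.nat_pow_Suc)
  also have "\<dots> = x [^] Suc (Suc n) \<otimes> d \<oplus> (x [^] Suc n \<oplus> ?c \<otimes> x [^] Suc n)"
    unfolding comm using x d by (simp add: r_distr m_assoc a_assoc del: add.nat_pow_Suc)
  also have "x [^] Suc n \<oplus> ?c \<otimes> x [^] Suc n = ([Suc (Suc n)] \<cdot> \<one>) \<otimes> x [^] Suc n"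
    using x
    by (simp only: add.nat_pow_Suc[of "Suc n"] l_distr l_one a_comm nat_pow_closed
        add.nat_pow_closed one_closed m_closed)
  finally show ?case .
qed

lemma (in left_module) smult_zero_right:
  assumes "a \<in> carrier R"
  shows "a \<odot>\<^bsub>M\<^esub> \<zero>\<^bsub>M\<^esub> = \<zero>\<^bsub>M\<^esub>"
proof -
  have "a \<odot>\<^bsub>M\<^esub> \<zero>\<^bsub>M\<^esub> = a \<odot>\<^bsub>M\<^esub> \<zero>\<^bsub>M\<^esub> \<oplus>\<^bsub>M\<^esub> a \<odot>\<^bsub>M\<^esub> \<zero>\<^bsub>M\<^esub>"
    using smult_r_distr[OF assms M.zero_closed M.zero_closed] by simp
  then show ?thesis
    using smult_closed[OF assms M.zero_closed] M.add.l_cancel_one by metis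
qed

lemma (in left_module) smult_Unit_eq_zero:
  assumes u: "u \<in> Units R" and y: "y \<in> carrier M" and "u \<odot>\<^bsub>M\<^esub> y = \<zero>\<^bsub>M\<^esub>"
  shows "y = \<zero>\<^bsub>M\<^esub>"
proof -
  have "y = (inv u \<otimes> u) \<odot>\<^bsub>M\<^esub> y" using u y by (simp add: smult_one)
  also have "\<dots> = inv u \<odot>\<^bsub>M\<^esub> (u \<odot>\<^bsub>M\<^esub> y)" using u y by (intro smult_assoc) auto
  finally show ?thesis using assms by (simp add: smult_zero_right)
qed

text \<open>
  Applying both sides of the commutator identity to \<open>y\<close> kills the two terms with
  \<open>x [^] Suc n\<close>, which leaves \<open>(n + 1) x\<^sup>n y = 0\<close>. Hence the exponent can be lowered until
  \<open>x\<^sup>0\<close>, the identity, annihilates the module.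
\<close>

lemma (in left_module) trivial_if_power_annihilates:
  fixes n :: nat
  assumes x: "x \<in> carrier R" and d: "d \<in> carrier R"
    and comm: "d \<otimes> x = x \<otimes> d \<oplus> \<one>"
    and units: "\<And>k::nat. k > 0 \<Longrightarrow> [k] \<cdot> \<one> \<in> Units R"
    and "\<forall>y\<in>carrier M. x [^] n \<odot>\<^bsub>M\<^esub> y = \<zero>\<^bsub>M\<^esub>"
  shows "carrier M = {\<zero>\<^bsub>M\<^esub>}"
  using assms(5)
proof (induction n)
  case 0
  then show ?case by (auto simp: smult_one)
next
  case (Suc n)
  have "x [^] n \<odot>\<^bsub>M\<^esub> y = \<zero>\<^bsub>M\<^esub>" if y: "y \<in> carrier M" for y
  proof (rule smult_Unit_eq_zero)
    let ?c = "[Suc n] \<cdot> \<one>"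
    have c: "?c \<in> carrier R" by (rule R.add.nat_pow_closed) simp
    have p: "x [^] k \<in> carrier R" for k :: nat using x by simp
    have dy: "d \<odot>\<^bsub>M\<^esub> y \<in> carrier M" using d y by (rule smult_closed)
    have "\<zero>\<^bsub>M\<^esub> = (d \<otimes> x [^] Suc n) \<odot>\<^bsub>M\<^esub> y"
      using Suc.prems y by (simp only: smult_assoc[OF d p y] smult_zero_right[OF d])
    also have "\<dots> = (x [^] Suc n \<otimes> d) \<odot>\<^bsub>M\<^esub> y \<oplus>\<^bsub>M\<^esub> (?c \<otimes> x [^] n) \<odot>\<^bsub>M\<^esub> y"
      unfolding R.commutator_power[OF x d comm] using p c d y
      by (intro smult_l_distr R.m_closed)
    also have "(x [^] Suc n \<otimes> d) \<odot>\<^bsub>M\<^esub> y = \<zero>\<^bsub>M\<^esub>"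
      using Suc.prems dy by (simp only: smult_assoc[OF p d y])
    also have "(?c \<otimes> x [^] n) \<odot>\<^bsub>M\<^esub> y = ?c \<odot>\<^bsub>M\<^esub> (x [^] n \<odot>\<^bsub>M\<^esub> y)"
      using c p y by (rule smult_assoc)
    finally show "?c \<odot>\<^bsub>M\<^esub> (x [^] n \<odot>\<^bsub>M\<^esub> y) = \<zero>\<^bsub>M\<^esub>"
      using smult_closed[OF c smult_closed[OF p y]] by simp
    show "x [^] n \<odot>\<^bsub>M\<^esub> y \<in> carrier M" using p y by (rule smult_closed)
  qed (rule units, simp)
  then show ?case by (intro Suc.IH) blast
qed

section \<open>Graded modules with finite support\<close>

lemma (in graded_left_module) component_subset: "Mgr i \<subseteq> carrier M"
  using direct_sum additive_subgroup.a_subset unfolding internal_direct_sum_def by blast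

lemma (in graded_left_module) annihilates_if_annihilates_components:
  assumes a: "a \<in> carrier R"
    and ann: "\<And>i y. y \<in> Mgr i \<Longrightarrow> a \<odot>\<^bsub>M\<^esub> y = \<zero>\<^bsub>M\<^esub>"
    and y: "y \<in> carrier M"
  shows "a \<odot>\<^bsub>M\<^esub> y = \<zero>\<^bsub>M\<^esub>"
proof -
  obtain f where f: "\<And>i. f i \<in> Mgr i" and fin: "finite {i. f i \<noteq> \<zero>\<^bsub>M\<^esub>}"
    and y_eq: "y = (\<Oplus>\<^bsub>M\<^esub>i\<in>{i. f i \<noteq> \<zero>\<^bsub>M\<^esub>}. f i)"
    using direct_sum y unfolding internal_direct_sum_def by blast
  have fM: "f i \<in> carrier M" for i using f component_subset by blast
  have "a \<odot>\<^bsub>M\<^esub> (\<Oplus>\<^bsub>M\<^esub>i\<in>S. f i) = \<zero>\<^bsub>M\<^esub>" if "finite S" for S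
    using that
  proof (induction S)
    case empty
    show ?case using a by (simp add: smult_zero_right)
  next
    case (insert i S)
    have "a \<odot>\<^bsub>M\<^esub> (\<Oplus>\<^bsub>M\<^esub>i\<in>insert i S. f i) = a \<odot>\<^bsub>M\<^esub> f i \<oplus>\<^bsub>M\<^esub> a \<odot>\<^bsub>M\<^esub> (\<Oplus>\<^bsub>M\<^esub>i\<in>S. f i)"
      using insert fM a by (simp add: smult_r_distr)
    then show ?case using insert ann[OF f] by simp
  qed
  then show ?thesis using fin y_eq by simp
qed

lemma (in graded_left_module) smult_power_graded:
  fixes k :: nat
  assumes x: "x \<in> carrier R" "x \<in> Rgr i" and "y \<in> Mgr j"
  shows "x [^] k \<odot>\<^bsub>M\<^esub> y \<in> Mgr (int k * i + j)"
  using \<open>y \<in> Mgr j\<close>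
proof (induction k arbitrary: y j)
  case 0
  then have "y \<in> carrier M" using component_subset by blast
  then show ?case using 0 by (simp add: smult_one)
next
  case (Suc k)
  have "x [^] Suc k \<odot>\<^bsub>M\<^esub> y = x [^] k \<odot>\<^bsub>M\<^esub> (x \<odot>\<^bsub>M\<^esub> y)"
    using x Suc.prems component_subset by (simp add: smult_assoc subset_iff)
  also have "\<dots> \<in> Mgr (int k * i + (i + j))"
    by (rule Suc.IH) (rule smult_graded[OF x(2) Suc.prems])
  finally show ?case by (simp add: algebra_simps)
qed

text \<open>
  The exponent depends only on the support, not on the element, so the same
  power kills all components.
\<close>

lemma (in graded_left_module) homogeneous_nilpotent_if_finite_support:
  assumes fin: "finite {n. Mgr n \<noteq> {\<zero>\<^bsub>M\<^esub>}}"
    and x: "x \<in> carrier R" "x \<in> Rgr i" and "i \<noteq> 0"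
  shows "\<exists>k::nat. \<forall>y\<in>carrier M. x [^] k \<odot>\<^bsub>M\<^esub> y = \<zero>\<^bsub>M\<^esub>"
proof -
  let ?S = "{n. Mgr n \<noteq> {\<zero>\<^bsub>M\<^esub>}}"
  \<comment> \<open>A shift that is larger than every difference of two degrees in the support.\<close>
  obtain b where b: "\<And>n. n \<in> ?S \<Longrightarrow> \<bar>n\<bar> \<le> b"
    using fin bdd_above_finite[of "abs ` ?S"] unfolding bdd_above_def by blast
  define k where "k = nat (2 * \<bar>b\<bar> + 1)"
  have "x [^] k \<odot>\<^bsub>M\<^esub> y = \<zero>\<^bsub>M\<^esub>" if y: "y \<in> Mgr j" for y j
  proof (cases "j \<in> ?S")
    case True
    have "int k * 1 \<le> int k * \<bar>i\<bar>" using \<open>i \<noteq> 0\<close> by (intro mult_left_mono) auto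
    then have "\<bar>int k * i\<bar> \<ge> int k" by (simp add: abs_mult)
    moreover have "int k > 2 * b" by (simp add: k_def)
    ultimately have "\<bar>int k * i + j\<bar> > b" using b[OF True] by linarith
    then have "int k * i + j \<notin> ?S" using b by fastforce
    then show ?thesis using smult_power_graded[OF x y] by auto
  next
    case False
    then show ?thesis using y x by (simp add: smult_zero_right)
  qed
  then show ?thesis using annihilates_if_annihilates_components x(1) R.nat_pow_closed by blast
qed

section \<open>Relations, degrees and integers in the Weyl algebra\<close>

text \<open>
  Constants are supported on the empty word, so convolution multiplies them as in \<open>R\<close>. Through
  this map the invertible elements of \<open>R\<close> become invertible in every quotient of the free algebra.
\<close>

lemma (in ring) free_algebra_const_hom:
  "(\<lambda>c w. if w = [] then c else \<zero>) \<in> ring_hom R (free_algebra R G)"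
proof (rule ring_hom_memI)
  fix a b assume ab: "a \<in> carrier R" "b \<in> carrier R"
  show "(\<lambda>w. if w = [] then a \<otimes> b else \<zero>)
    = (\<lambda>w. if w = [] then a else \<zero>) \<otimes>\<^bsub>free_algebra R G\<^esub> (\<lambda>w. if w = [] then b else \<zero>)"
  proof
    fix w :: "'c list"
    have "(\<Oplus>k\<in>{..length w}. (if take k w = [] then a else \<zero>) \<otimes> (if drop k w = [] then b else \<zero>))
      = (\<Oplus>k\<in>{..length w}. if w = [] then a \<otimes> b else \<zero>)"
      using ab by (intro finsum_cong') auto
    then show "(if w = [] then a \<otimes> b else \<zero>)
      = ((\<lambda>w. if w = [] then a else \<zero>) \<otimes>\<^bsub>free_algebra R G\<^esub> (\<lambda>w. if w = [] then b else \<zero>)) w"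
      using ab by (cases "w = []") (auto simp: free_algebra_def)
  qed
qed (auto simp: free_algebra_def)

lemma (in ring) weyl_class_ring_hom:
  "ring_hom_ring (free_algebra R (weyl_gens m)) (weyl_algebra R m) (weyl_class R m)"
  using ideal.rcos_ring_hom_ring[OF weyl_ideal_is_ideal[of m]]
  unfolding weyl_algebra_def weyl_class_def[abs_def] .

lemma (in ring) weyl_class_ideal:
  assumes "f \<in> weyl_ideal R m"
  shows "weyl_class R m f = \<zero>\<^bsub>weyl_algebra R m\<^esub>"
proof -
  interpret I: ideal "weyl_ideal R m" "free_algebra R (weyl_gens m)" by (rule weyl_ideal_is_ideal)
  show ?thesis
    using I.a_rcos_const[OF assms] by (simp add: weyl_class_def weyl_algebra_def FactRing_def)
qed

lemma (in ring) eq_relator_plus: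
  assumes "a \<in> carrier R" "b \<in> carrier R" "c \<in> carrier R"
  shows "a = ((a \<ominus> b) \<ominus> c) \<oplus> (b \<oplus> c)"
  using assms by (simp add: a_minus_def a_ac r_neg r_neg1)

lemma (in ring) weyl_relation:
  assumes i: "i \<in> {1..m}"
  defines "W \<equiv> weyl_algebra R m"
  shows "weyl_D R m i \<otimes>\<^bsub>W\<^esub> weyl_X R m i = weyl_X R m i \<otimes>\<^bsub>W\<^esub> weyl_D R m i \<oplus>\<^bsub>W\<^esub> \<one>\<^bsub>W\<^esub>"
proof -
  let ?F = "free_algebra R (weyl_gens m)"
  let ?x = "free_letter R (GenX i)" and ?d = "free_letter R (GenD i)"
  interpret h: ring_hom_ring ?F W "weyl_class R m"
    unfolding W_def by (rule weyl_class_ring_hom)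
  have xd: "?x \<in> carrier ?F" "?d \<in> carrier ?F"
    using i by (auto intro!: free_letter_closed simp: weyl_gens_def)
  let ?r = "(?d \<otimes>\<^bsub>?F\<^esub> ?x \<ominus>\<^bsub>?F\<^esub> ?x \<otimes>\<^bsub>?F\<^esub> ?d) \<ominus>\<^bsub>?F\<^esub> \<one>\<^bsub>?F\<^esub>"
  have "?r \<in> weyl_relators R m"
    unfolding weyl_relators_def Let_def
    by (intro UnI2 CollectI exI[of _ i]) (use i in simp)
  then have "?r \<in> weyl_ideal R m"
    unfolding weyl_ideal_def genideal_def by blast
  then have r0: "weyl_class R m ?r = \<zero>\<^bsub>W\<^esub>"
    using weyl_class_ideal by (simp add: W_def)
  let ?t = "?x \<otimes>\<^bsub>?F\<^esub> ?d \<oplus>\<^bsub>?F\<^esub> \<one>\<^bsub>?F\<^esub>"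
  have "?d \<otimes>\<^bsub>?F\<^esub> ?x = ?r \<oplus>\<^bsub>?F\<^esub> ?t"
    by (rule ring.eq_relator_plus[OF h.R.ring_axioms]) (simp_all add: xd)
  then have "weyl_class R m (?d \<otimes>\<^bsub>?F\<^esub> ?x) = weyl_class R m (?r \<oplus>\<^bsub>?F\<^esub> ?t)"
    by (rule arg_cong)
  also have "\<dots> = weyl_class R m ?r \<oplus>\<^bsub>W\<^esub> weyl_class R m ?t"
    by (rule h.hom_add) (simp_all add: xd)
  finally show ?thesis using xd by (simp add: r0 weyl_X_def weyl_D_def)
qed

lemma (in ring) weyl_X_homogeneous:
  assumes "i \<in> {1..m}"
  shows "weyl_X R m i \<in> weyl_component R m 1"
proof -
  have "free_letter R (GenX i) \<in> carrier (free_algebra R (weyl_gens m))"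
    using assms by (auto intro!: free_letter_closed simp: weyl_gens_def)
  moreover have "sum_list (map gen_degree w) = 1" if "free_letter R (GenX i) w \<noteq> \<zero>" for w
    using that by (auto simp: free_letter_def split: if_splits)
  ultimately show ?thesis
    unfolding weyl_component_def weyl_X_def by (intro imageI) auto
qed

lemma ring_hom_add_pow_one:
  fixes n :: nat
  assumes "ring_hom_ring R S h"
  shows "h ([n] \<cdot>\<^bsub>R\<^esub> \<one>\<^bsub>R\<^esub>) = [n] \<cdot>\<^bsub>S\<^esub> \<one>\<^bsub>S\<^esub>"
proof -
  interpret ring_hom_ring R S h by fact
  show ?thesis by (induction n) auto
qed

lemma add_pow_carrier_update: "[n] \<cdot>\<^bsub>R\<lparr>carrier := K\<rparr>\<^esub> a = [n] \<cdot>\<^bsub>R\<^esub> a" for n :: nat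
  by (simp add: add_pow_def nat_pow_def)

text \<open>
  The integer \<open>n\<close> of the Weyl algebra is the image of the integer \<open>n\<close> of \<open>R\<close>, and the latter has
  an inverse in \<open>K\<close>; ring homomorphisms preserve inverses.
\<close>

lemma (in ring) weyl_integers_are_Units:
  fixes n m :: nat
  assumes K: "subfield K R" and "[n] \<cdot> \<one> \<noteq> \<zero>"
  shows "[n] \<cdot>\<^bsub>weyl_algebra R m\<^esub> \<one>\<^bsub>weyl_algebra R m\<^esub> \<in> Units (weyl_algebra R m)"
proof -
  let ?W = "weyl_algebra R m"
  define h where "h = weyl_class R m \<circ> (\<lambda>c w. if w = [] then c else \<zero>)"
  have hom: "h \<in> ring_hom R ?W"
    unfolding h_def
    using free_algebra_const_hom ring_hom_ring.homh[OF weyl_class_ring_hom]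
    by (rule ring_hom_trans)
  interpret W: ring ?W by (rule weyl_algebra_is_ring)
  have rh: "ring_hom_ring R ?W h" by (rule ring_hom_ringI2[OF ring_axioms W.ring_axioms hom])
  interpret h: ring_hom_ring R ?W h by (rule rh)
  have one: "\<one> \<in> K" and sr: "subring K R"
    using K subfieldE(1)[OF K] by (auto intro: subringE(3))
  have "[n] \<cdot> \<one> \<in> K"
    using one sr by (induction n) (auto intro: subringE)
  then have n: "[n] \<cdot> \<one> \<in> K - {\<zero>}" using assms by simp
  define c where "c = inv ([n] \<cdot> \<one>)"
  have "c \<in> K" using subfield_m_inv(1)[OF K n] by (simp add: c_def)
  then have c: "c \<in> carrier R" "c \<otimes> [n] \<cdot> \<one> = \<one>" "[n] \<cdot> \<one> \<otimes> c = \<one>"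
    using subringE(1)[OF sr] subfield_m_inv(2,3)[OF K n] by (auto simp: c_def)
  have "h c \<otimes>\<^bsub>?W\<^esub> h ([n] \<cdot> \<one>) = \<one>\<^bsub>?W\<^esub>" "h ([n] \<cdot> \<one>) \<otimes>\<^bsub>?W\<^esub> h c = \<one>\<^bsub>?W\<^esub>"
    using c by (simp_all flip: h.hom_mult)
  then show ?thesis
    unfolding ring_hom_add_pow_one[OF rh] Units_def using c(1) by auto
qed

section \<open>Infinitely many nonzero components\<close>

theorem corollary6p5:
  fixes A :: "('a, 'c) ring_scheme" and K :: "'a set" and m :: nat
    and M :: "((weyl_gen list \<Rightarrow> 'a) set, 'b, 'q) module_scheme"
    and Mgr :: "int \<Rightarrow> 'b set"
  assumes "cring A" and "noetherian_ring A"
    and "subfield K A" and "uncountable K"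
    and char_zero: "\<forall>n::nat. n > 0 \<longrightarrow> [n] \<cdot>\<^bsub>A\<lparr>carrier := K\<rparr>\<^esub> \<one>\<^bsub>A\<^esub> \<noteq> \<zero>\<^bsub>A\<^esub>"
    and "m \<ge> 1"
    and "graded_left_module (weyl_algebra A m) (weyl_component A m) M Mgr"
    and "countably_generated (weyl_algebra A m) M"
    and "generalized_eulerian A m M Mgr"
    and "carrier M \<noteq> {\<zero>\<^bsub>M\<^esub>}"
  shows "infinite {n. n > 0 \<and> Mgr n \<noteq> {\<zero>\<^bsub>M\<^esub>}} \<or> infinite {n. n < 0 \<and> Mgr n \<noteq> {\<zero>\<^bsub>M\<^esub>}}"
proof (rule ccontr)
  let ?W = "weyl_algebra A m"
  assume "\<not> ?thesis"
  then have "finite ({n. n > 0 \<and> Mgr n \<noteq> {\<zero>\<^bsub>M\<^esub>}} \<union> {n. n < 0 \<and> Mgr n \<noteq> {\<zero>\<^bsub>M\<^esub>}} \<union> {0})"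
    by simp
  then have fin: "finite {n. Mgr n \<noteq> {\<zero>\<^bsub>M\<^esub>}}"
    by (rule rev_finite_subset) auto
  interpret A: cring A by fact
  interpret graded_left_module ?W "weyl_component A m" M Mgr by fact
  interpret h: ring_hom_ring "free_algebra A (weyl_gens m)" ?W "weyl_class A m"
    by (rule A.weyl_class_ring_hom)
  have i: "1 \<in> {1..m}" using \<open>m \<ge> 1\<close> by simp
  have X: "weyl_X A m 1 \<in> carrier ?W" and D: "weyl_D A m 1 \<in> carrier ?W"
    unfolding weyl_X_def weyl_D_def
    using i by (auto intro!: h.hom_closed A.free_letter_closed simp: weyl_gens_def)
  obtain k :: nat where "\<forall>y\<in>carrier M. weyl_X A m 1 [^]\<^bsub>?W\<^esub> k \<odot>\<^bsub>M\<^esub> y = \<zero>\<^bsub>M\<^esub>"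
    using homogeneous_nilpotent_if_finite_support[OF fin X A.weyl_X_homogeneous[OF i]] by auto
  moreover have "[n] \<cdot>\<^bsub>?W\<^esub> \<one>\<^bsub>?W\<^esub> \<in> Units ?W" if "n > 0" for n :: nat
    using that char_zero A.weyl_integers_are_Units[OF \<open>subfield K A\<close>]
    by (simp add: add_pow_carrier_update)
  ultimately have "carrier M = {\<zero>\<^bsub>M\<^esub>}"
    using trivial_if_power_annihilates[OF X D A.weyl_relation[OF i]] by blast
  with \<open>carrier M \<noteq> {\<zero>\<^bsub>M\<^esub>}\<close> show False by contradiction
qed

end
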